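(* Let $R$ be a ring and let $I$ be a pure ideal of $R$. Then $\operatorname{End}(I^{n})$ is a commutative ring for all $n\geqslant 1$.
   Context: All rings are commutative with identity. An ideal $I$ of $R$ is pure if the canonical homomorphism $R\to R/I$ is flat; equivalently, for each $a\in I$ there exists $b\in I$ with $a(1-b)=0$. $\operatorname{End}(I^n)$ denotes the ring of $R$-module endomorphisms of the ideal $I^n$ (multiplication being composition). *)

theory Defs
  imports "HOL-Algebra.Free_Abelian_Groups" "HOL-Algebra.Module" "HOL-Algebra.QuotRing"
    "HOL-Algebra.Ideal_Product"
begin

section \<open>Linear maps and endomorphism rings\<close>

definition linear_maps ::
    "('a, 'r) ring_scheme \<Rightarrow> ('a, 'm, 'c) module_scheme \<Rightarrow> ('a, 'n, 'd) module_scheme \<Rightarrow> ('m \<Rightarrow> 'n) set"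
  where "linear_maps R M N =
    {f \<in> carrier M \<rightarrow> carrier N.
       (\<forall>x\<in>carrier M. \<forall>y\<in>carrier M. f (x \<oplus>\<^bsub>M\<^esub> y) = f x \<oplus>\<^bsub>N\<^esub> f y) \<and>
       (\<forall>r\<in>carrier R. \<forall>x\<in>carrier M. f (r \<odot>\<^bsub>M\<^esub> x) = r \<odot>\<^bsub>N\<^esub> f x)}"

text \<open>Endomorphisms are taken extensional, so that equality of functions is equality of
  endomorphisms.\<close>

definition End_ring :: "('a, 'r) ring_scheme \<Rightarrow> ('a, 'm, 'c) module_scheme \<Rightarrow> ('m \<Rightarrow> 'm) ring"
  where "End_ring R M =
    \<lparr>carrier = linear_maps R M M \<inter> extensional (carrier M),
     mult = compose (carrier M),
     one = (\<lambda>x\<in>carrier M. x),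
     zero = (\<lambda>x\<in>carrier M. \<zero>\<^bsub>M\<^esub>),
     add = (\<lambda>f g. \<lambda>x\<in>carrier M. f x \<oplus>\<^bsub>M\<^esub> g x)\<rparr>"

text \<open>An ideal as a module. The fields \<open>mult\<close> and \<open>one\<close> of a module record play no role in
  the locale \<^locale>\<open>module\<close>.\<close>

definition ideal_module :: "('a, 'r) ring_scheme \<Rightarrow> 'a set \<Rightarrow> ('a, 'a) module"
  where "ideal_module R J =
    \<lparr>carrier = J, mult = mult R, one = \<one>\<^bsub>R\<^esub>, zero = \<zero>\<^bsub>R\<^esub>, add = add R,
     smult = mult R\<rparr>"

section \<open>Tensor products\<close>

text \<open>The tensor product of two modules over a commutative ring, as an abelian group (written
  multiplicatively): the free abelian group on the pairs, modulo the usual relations.\<close>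

definition tensor_free ::
    "('a, 'm, 'c) module_scheme \<Rightarrow> ('a, 'n, 'd) module_scheme \<Rightarrow> ('m \<times> 'n \<Rightarrow>\<^sub>0 int) monoid"
  where "tensor_free N M = free_Abelian_group (carrier N \<times> carrier M)"

definition tensor_rel ::
    "('a, 'r) ring_scheme \<Rightarrow> ('a, 'm, 'c) module_scheme \<Rightarrow> ('a, 'n, 'd) module_scheme
      \<Rightarrow> ('m \<times> 'n \<Rightarrow>\<^sub>0 int) set"
  where "tensor_rel R N M = generate (tensor_free N M)
    ({frag_of (x \<oplus>\<^bsub>N\<^esub> x', y) - frag_of (x, y) - frag_of (x', y) | x x' y.
        x \<in> carrier N \<and> x' \<in> carrier N \<and> y \<in> carrier M} \<union>
     {frag_of (x, y \<oplus>\<^bsub>M\<^esub> y') - frag_of (x, y) - frag_of (x, y') | x y y'.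
        x \<in> carrier N \<and> y \<in> carrier M \<and> y' \<in> carrier M} \<union>
     {frag_of (r \<odot>\<^bsub>N\<^esub> x, y) - frag_of (x, r \<odot>\<^bsub>M\<^esub> y) | r x y.
        r \<in> carrier R \<and> x \<in> carrier N \<and> y \<in> carrier M})"

definition tensor ::
    "('a, 'r) ring_scheme \<Rightarrow> ('a, 'm, 'c) module_scheme \<Rightarrow> ('a, 'n, 'd) module_scheme
      \<Rightarrow> ('m \<times> 'n \<Rightarrow>\<^sub>0 int) set monoid"
  where "tensor R N M = tensor_free N M Mod tensor_rel R N M"

text \<open>For linear \<open>f : N \<rightarrow> N'\<close> this is \<open>f \<otimes> id : N \<otimes> M \<rightarrow> N' \<otimes> M\<close>. All the cosets in the union
  are equal.\<close>

definition tensor_map ::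
    "('a, 'r) ring_scheme \<Rightarrow> ('a, 'm, 'c) module_scheme \<Rightarrow> ('a, 'n, 'd) module_scheme
      \<Rightarrow> ('k \<Rightarrow> 'm) \<Rightarrow> ('k \<times> 'n \<Rightarrow>\<^sub>0 int) set \<Rightarrow> ('m \<times> 'n \<Rightarrow>\<^sub>0 int) set"
  where "tensor_map R N' M f X =
    (\<Union>c\<in>X. tensor_rel R N' M #>\<^bsub>tensor_free N' M\<^esub> frag_extend (\<lambda>(x, y). frag_of (f x, y)) c)"

section \<open>Flatness and pure ideals\<close>

text \<open>Tensoring with a flat module preserves injectivity. The type argument is the type from which
  the carriers of the test modules are taken.\<close>

definition flat_module :: "'n itself \<Rightarrow> ('a, 'r) ring_scheme \<Rightarrow> ('a, 'm, 'c) module_scheme \<Rightarrow> bool"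
  where "flat_module _ R M \<longleftrightarrow> module R M \<and>
    (\<forall>(N :: ('a, 'n) module) (N' :: ('a, 'n) module) f.
       module R N \<longrightarrow> module R N' \<longrightarrow> f \<in> linear_maps R N N' \<longrightarrow> inj_on f (carrier N) \<longrightarrow>
       inj_on (tensor_map R N' M f) (carrier (tensor R N M)))"

definition restrict_scalars ::
    "('b, 's) ring_scheme \<Rightarrow> ('a \<Rightarrow> 'b) \<Rightarrow> ('a, 'b) module"
  where "restrict_scalars S h =
    \<lparr>carrier = carrier S, mult = mult S, one = \<one>\<^bsub>S\<^esub>, zero = \<zero>\<^bsub>S\<^esub>, add = add S,
     smult = (\<lambda>r x. h r \<otimes>\<^bsub>S\<^esub> x)\<rparr>"

definition flat_hom ::
    "'n itself \<Rightarrow> ('a, 'r) ring_scheme \<Rightarrow> ('b, 's) ring_scheme \<Rightarrow> ('a \<Rightarrow> 'b) \<Rightarrow> bool"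
  where "flat_hom T R S h \<longleftrightarrow> h \<in> ring_hom R S \<and> flat_module T R (restrict_scalars S h)"

text \<open>A definition cannot quantify over all types. Taking the test modules over the element type of
  \<open>R\<close> covers the inclusions \<open>J \<rightarrow> R\<close> of ideals, which suffice to detect flatness.
  No generality is lost: by \<open>pure_ideal_flat\<close> below, \<open>R Quot I\<close> is then flat with respect to
  test modules of every type, and \<open>pure_ideal_iff\<close> gives the elementwise description.\<close>

definition pure_ideal :: "'a set \<Rightarrow> ('a, 'r) ring_scheme \<Rightarrow> bool"
  where "pure_ideal I R \<longleftrightarrow> ideal I R \<and> flat_hom TYPE('a) R (R Quot I) (\<lambda>r. I +>\<^bsub>R\<^esub> r)"

subsection \<open>The elementwise description of purity\<close>

lemma tensor_free_simps [simp]: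
  "c \<in> carrier (tensor_free N M) \<longleftrightarrow> Poly_Mapping.keys c \<subseteq> carrier N \<times> carrier M"
  "c \<otimes>\<^bsub>tensor_free N M\<^esub> d = c + d"
  "\<one>\<^bsub>tensor_free N M\<^esub> = 0"
  by (auto simp: tensor_free_def)

lemma comm_group_tensor_free: "comm_group (tensor_free N M)"
  by (simp add: tensor_free_def abelian_free_Abelian_group)

lemma inv_tensor_free [simp]:
  "Poly_Mapping.keys c \<subseteq> carrier N \<times> carrier M \<Longrightarrow> inv\<^bsub>tensor_free N M\<^esub> c = - c"
  by (simp add: tensor_free_def)

lemma keys_diff_subset:
  "\<lbrakk>Poly_Mapping.keys a \<subseteq> S; Poly_Mapping.keys b \<subseteq> S\<rbrakk> \<Longrightarrow> Poly_Mapping.keys (a - b :: _ \<Rightarrow>\<^sub>0 int) \<subseteq> S"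
  by (meson Un_least keys_diff order_trans)

lemma subgroup_tensor_rel:
  assumes "module R N" "module R M"
  shows "subgroup (tensor_rel R N M) (tensor_free N M)"
proof -
  interpret N: module R N by fact
  interpret M: module R M by fact
  interpret F: comm_group "tensor_free N M" by (rule comm_group_tensor_free)
  show ?thesis
    unfolding tensor_rel_def
    by (rule F.generate_is_subgroup) (auto dest!: keys_diff[THEN subsetD])
qed

lemma tensor_rel_closed:
  assumes "module R N" "module R M"
  shows "0 \<in> tensor_rel R N M"
    and "\<lbrakk>a \<in> tensor_rel R N M; b \<in> tensor_rel R N M\<rbrakk> \<Longrightarrow> a + b \<in> tensor_rel R N M"
    and "a \<in> tensor_rel R N M \<Longrightarrow> - a \<in> tensor_rel R N M"
    and "\<lbrakk>a \<in> tensor_rel R N M; b \<in> tensor_rel R N M\<rbrakk> \<Longrightarrow> a - b \<in> tensor_rel R N M"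
    and "a \<in> tensor_rel R N M \<Longrightarrow> Poly_Mapping.keys a \<subseteq> carrier N \<times> carrier M"
proof -
  note H = subgroup_tensor_rel[OF assms]
  show 0: "0 \<in> tensor_rel R N M" using subgroup.one_closed[OF H] by simp
  show P: "a + b \<in> tensor_rel R N M" if "a \<in> tensor_rel R N M" "b \<in> tensor_rel R N M" for a b
    using subgroup.m_closed[OF H that] by simp
  show K: "Poly_Mapping.keys a \<subseteq> carrier N \<times> carrier M" if "a \<in> tensor_rel R N M" for a
    using subgroup.mem_carrier[OF H that] by simp
  show M: "- a \<in> tensor_rel R N M" if "a \<in> tensor_rel R N M" for a
    using subgroup.m_inv_closed[OF H that] K[OF that] by simp
  show "a - b \<in> tensor_rel R N M" if "a \<in> tensor_rel R N M" "b \<in> tensor_rel R N M"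
    using P[OF that(1) M[OF that(2)]] by simp
qed

lemma tensor_rel_basic:
  shows "\<lbrakk>x \<in> carrier N; x' \<in> carrier N; y \<in> carrier M\<rbrakk> \<Longrightarrow>
      frag_of (x \<oplus>\<^bsub>N\<^esub> x', y) - frag_of (x, y) - frag_of (x', y) \<in> tensor_rel R N M"
    and "\<lbrakk>x \<in> carrier N; y \<in> carrier M; y' \<in> carrier M\<rbrakk> \<Longrightarrow>
      frag_of (x, y \<oplus>\<^bsub>M\<^esub> y') - frag_of (x, y) - frag_of (x, y') \<in> tensor_rel R N M"
    and "\<lbrakk>r \<in> carrier R; x \<in> carrier N; y \<in> carrier M\<rbrakk> \<Longrightarrow>
      frag_of (r \<odot>\<^bsub>N\<^esub> x, y) - frag_of (x, r \<odot>\<^bsub>M\<^esub> y) \<in> tensor_rel R N M"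
  unfolding tensor_rel_def by (rule generate.incl; blast)+

lemma (in group) rcos_eq_iff:
  assumes H: "subgroup H G" and cd: "c \<in> carrier G" "d \<in> carrier G"
  shows "H #> c = H #> d \<longleftrightarrow> c \<otimes> inv d \<in> H"
proof
  assume "H #> c = H #> d"
  then have "H #> (c \<otimes> inv d) = H"
    by (rule coset_mult_inv2[OF _ cd subgroup.subset[OF H]])
  then show "c \<otimes> inv d \<in> H"
    by (rule coset_join1[OF _ _ H]) (use cd in simp)
next
  assume "c \<otimes> inv d \<in> H"
  then have "H #> (c \<otimes> inv d) = H"
    by (intro coset_join2[OF _ H]) (use cd in simp_all)
  then show "H #> c = H #> d"
    by (rule coset_mult_inv1[OF _ cd subgroup.subset[OF H]])
qed

lemma tensor_rel_map:
  assumes N: "module R N" and N': "module R N'" and M: "module R M" and f: "f \<in> linear_maps R N N'"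
    and c: "c \<in> tensor_rel R N M"
  shows "frag_extend (\<lambda>(x, y). frag_of (f x, y)) c \<in> tensor_rel R N' M"
proof -
  let ?F = "tensor_free N M" and ?H' = "tensor_rel R N' M"
  let ?g = "frag_extend (\<lambda>(x, y). frag_of (f x, y))"
  note cl = tensor_rel_closed[OF N M] and cl' = tensor_rel_closed[OF N' M]
  have fN: "f x \<in> carrier N'" if "x \<in> carrier N" for x
    using f that by (auto simp: linear_maps_def)
  have fadd: "f (x \<oplus>\<^bsub>N\<^esub> y) = f x \<oplus>\<^bsub>N'\<^esub> f y" if "x \<in> carrier N" "y \<in> carrier N" for x y
    using f that by (simp add: linear_maps_def)
  have fsmult: "f (r \<odot>\<^bsub>N\<^esub> x) = r \<odot>\<^bsub>N'\<^esub> f x" if "r \<in> carrier R" "x \<in> carrier N" for r x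
    using f that by (simp add: linear_maps_def)
  let ?S = "{frag_of (x \<oplus>\<^bsub>N\<^esub> x', y) - frag_of (x, y) - frag_of (x', y) | x x' y.
        x \<in> carrier N \<and> x' \<in> carrier N \<and> y \<in> carrier M} \<union>
     {frag_of (x, y \<oplus>\<^bsub>M\<^esub> y') - frag_of (x, y) - frag_of (x, y') | x y y'.
        x \<in> carrier N \<and> y \<in> carrier M \<and> y' \<in> carrier M} \<union>
     {frag_of (r \<odot>\<^bsub>N\<^esub> x, y) - frag_of (x, r \<odot>\<^bsub>M\<^esub> y) | r x y.
        r \<in> carrier R \<and> x \<in> carrier N \<and> y \<in> carrier M}"
  have S: "?g h \<in> ?H'" if "h \<in> ?S" for h
    using that
  proof (elim UnE CollectE exE conjE)
    fix x x' y assume "h = frag_of (x \<oplus>\<^bsub>N\<^esub> x', y) - frag_of (x, y) - frag_of (x', y)"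
      "x \<in> carrier N" "x' \<in> carrier N" "y \<in> carrier M"
    then show ?thesis
      using tensor_rel_basic(1)[OF fN fN, of x x' y M R] by (simp add: frag_extend_diff fadd)
  next
    fix x y y' assume "h = frag_of (x, y \<oplus>\<^bsub>M\<^esub> y') - frag_of (x, y) - frag_of (x, y')"
      "x \<in> carrier N" "y \<in> carrier M" "y' \<in> carrier M"
    then show ?thesis
      using tensor_rel_basic(2)[OF fN, of x y M y' R] by (simp add: frag_extend_diff)
  next
    fix r x y assume "h = frag_of (r \<odot>\<^bsub>N\<^esub> x, y) - frag_of (x, r \<odot>\<^bsub>M\<^esub> y)"
      "r \<in> carrier R" "x \<in> carrier N" "y \<in> carrier M"
    then show ?thesis
      using tensor_rel_basic(3)[OF _ fN, of r R x y M] by (simp add: frag_extend_diff fsmult)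
  qed
  show ?thesis
    using c unfolding tensor_rel_def[of R N M]
  proof (induction rule: generate.induct)
    case one
    show ?case using cl'(1) by simp
  next
    case (incl h)
    then show ?case by (rule S)
  next
    case (inv h)
    then have "h \<in> tensor_rel R N M" unfolding tensor_rel_def by (rule generate.incl)
    then have "inv\<^bsub>?F\<^esub> h = - h" using cl(5) by simp
    then show ?case using cl'(3)[OF S[OF inv]] by (simp add: frag_extend_minus)
  next
    case (eng h1 h2)
    show ?case using cl'(2)[OF eng(3,4)] by (simp add: frag_extend_add)
  qed
qed

lemma inj_tensor_map_iff:
  assumes N: "module R N" and N': "module R N'" and M: "module R M" and f: "f \<in> linear_maps R N N'"
  shows "inj_on (tensor_map R N' M f) (carrier (tensor R N M)) \<longleftrightarrow>
    (\<forall>c\<in>carrier (tensor_free N M).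
       frag_extend (\<lambda>(x, y). frag_of (f x, y)) c \<in> tensor_rel R N' M \<longrightarrow> c \<in> tensor_rel R N M)"
proof -
  let ?F = "tensor_free N M" and ?F' = "tensor_free N' M"
  let ?H = "tensor_rel R N M" and ?H' = "tensor_rel R N' M"
  let ?g = "frag_extend (\<lambda>(x, y). frag_of (f x, y))"
  interpret N: module R N by fact
  interpret N': module R N' by fact
  interpret M: module R M by fact
  interpret F: comm_group ?F by (rule comm_group_tensor_free)
  interpret F': comm_group ?F' by (rule comm_group_tensor_free)
  note H = subgroup_tensor_rel[OF N M] and H' = subgroup_tensor_rel[OF N' M]
  note c = tensor_rel_closed[OF N M] and c' = tensor_rel_closed[OF N' M]
  have fN: "f x \<in> carrier N'" if "x \<in> carrier N" for x
    using f that by (auto simp: linear_maps_def)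
  have g: "?g c \<in> carrier ?F'" if "c \<in> carrier ?F" for c
  proof -
    have "Poly_Mapping.keys (case p of (x, y) \<Rightarrow> frag_of (f x, y)) \<subseteq> carrier N' \<times> carrier M"
      if "p \<in> Poly_Mapping.keys c" for p
      using that \<open>c \<in> carrier ?F\<close> fN by (cases p) auto
    then have "Poly_Mapping.keys (?g c) \<subseteq> carrier N' \<times> carrier M"
      by (intro order_trans[OF keys_frag_extend] UN_least)
    then show ?thesis by simp
  qed
  have gH: "?g c \<in> ?H'" if "c \<in> ?H" for c
    by (rule tensor_rel_map[OF N N' M f that])
  have coset_eq: "?H #>\<^bsub>?F\<^esub> c = ?H #>\<^bsub>?F\<^esub> d \<longleftrightarrow> c - d \<in> ?H"
    if "c \<in> carrier ?F" "d \<in> carrier ?F" for c d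
    using that F.rcos_eq_iff[OF H that] by simp
  have coset_eq': "?H' #>\<^bsub>?F'\<^esub> c = ?H' #>\<^bsub>?F'\<^esub> d \<longleftrightarrow> c - d \<in> ?H'"
    if "c \<in> carrier ?F'" "d \<in> carrier ?F'" for c d
    using that F'.rcos_eq_iff[OF H' that] by simp
  have map: "tensor_map R N' M f (?H #>\<^bsub>?F\<^esub> c) = ?H' #>\<^bsub>?F'\<^esub> ?g c" if cF: "c \<in> carrier ?F" for c
  proof -
    have "?H' #>\<^bsub>?F'\<^esub> ?g d = ?H' #>\<^bsub>?F'\<^esub> ?g c" if d: "d \<in> ?H #>\<^bsub>?F\<^esub> c" for d
    proof -
      obtain h where h: "h \<in> ?H" "d = h + c" using d by (auto simp: r_coset_def)
      then have dF: "d \<in> carrier ?F"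
        using F.m_closed[of h c] cF c(5) by simp
      show ?thesis
        using coset_eq'[OF g[OF dF] g[OF cF]] gH[OF h(1)] h(2)
        by (simp add: frag_extend_add)
    qed
    then have "tensor_map R N' M f (?H #>\<^bsub>?F\<^esub> c) = (\<Union>d\<in>?H #>\<^bsub>?F\<^esub> c. ?H' #>\<^bsub>?F'\<^esub> ?g c)"
      unfolding tensor_map_def by (intro SUP_cong refl)
    moreover have "c \<in> ?H #>\<^bsub>?F\<^esub> c" by (rule F.rcos_self[OF cF H])
    then have "?H #>\<^bsub>?F\<^esub> c \<noteq> {}" by blast
    ultimately show ?thesis by simp
  qed
  have carr: "carrier (tensor R N M) = (\<lambda>c. ?H #>\<^bsub>?F\<^esub> c) ` carrier ?F"
    by (auto simp: tensor_def FactGroup_def RCOSETS_def)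
  show ?thesis
  proof
    assume inj: "inj_on (tensor_map R N' M f) (carrier (tensor R N M))"
    show "\<forall>c\<in>carrier ?F. ?g c \<in> ?H' \<longrightarrow> c \<in> ?H"
    proof (intro ballI impI)
      fix c assume cF: "c \<in> carrier ?F" and gc: "?g c \<in> ?H'"
      have z: "0 \<in> carrier ?F" by simp
      have "tensor_map R N' M f (?H #>\<^bsub>?F\<^esub> c) = tensor_map R N' M f (?H #>\<^bsub>?F\<^esub> 0)"
        unfolding map[OF cF] map[OF z] using coset_eq'[OF g[OF cF] g[OF z]] gc by simp
      then have "?H #>\<^bsub>?F\<^esub> c = ?H #>\<^bsub>?F\<^esub> 0"
        using inj cF z unfolding carr inj_on_def by blast
      then show "c \<in> ?H" using coset_eq[OF cF z] by simp
    qed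
  next
    assume *: "\<forall>c\<in>carrier ?F. ?g c \<in> ?H' \<longrightarrow> c \<in> ?H"
    show "inj_on (tensor_map R N' M f) (carrier (tensor R N M))"
      unfolding carr
    proof (rule inj_onI, clarify)
      fix c d assume cF: "c \<in> carrier ?F" and dF: "d \<in> carrier ?F"
        and eq: "tensor_map R N' M f (?H #>\<^bsub>?F\<^esub> c) = tensor_map R N' M f (?H #>\<^bsub>?F\<^esub> d)"
      have "c - d \<in> carrier ?F" using cF dF by (simp add: keys_diff_subset)
      moreover have "?g (c - d) \<in> ?H'"
        using eq unfolding map[OF cF] map[OF dF] coset_eq'[OF g[OF cF] g[OF dF]] frag_extend_diff .
      ultimately show "?H #>\<^bsub>?F\<^esub> c = ?H #>\<^bsub>?F\<^esub> d"
        using * coset_eq[OF cF dF] by blast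
    qed
  qed
qed

lemma tensor_lift:
  assumes N: "module R N" and M: "module R M" and G: "comm_group G"
    and \<phi>: "\<And>x y. \<lbrakk>x \<in> carrier N; y \<in> carrier M\<rbrakk> \<Longrightarrow> \<phi> x y \<in> carrier G"
    and \<phi>1: "\<And>x x' y. \<lbrakk>x \<in> carrier N; x' \<in> carrier N; y \<in> carrier M\<rbrakk> \<Longrightarrow>
      \<phi> (x \<oplus>\<^bsub>N\<^esub> x') y = \<phi> x y \<otimes>\<^bsub>G\<^esub> \<phi> x' y"
    and \<phi>2: "\<And>x y y'. \<lbrakk>x \<in> carrier N; y \<in> carrier M; y' \<in> carrier M\<rbrakk> \<Longrightarrow>
      \<phi> x (y \<oplus>\<^bsub>M\<^esub> y') = \<phi> x y \<otimes>\<^bsub>G\<^esub> \<phi> x y'"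
    and \<phi>3: "\<And>r x y. \<lbrakk>r \<in> carrier R; x \<in> carrier N; y \<in> carrier M\<rbrakk> \<Longrightarrow>
      \<phi> (r \<odot>\<^bsub>N\<^esub> x) y = \<phi> x (r \<odot>\<^bsub>M\<^esub> y)"
    and xy: "x \<in> carrier N" "y \<in> carrier M" "frag_of (x, y) \<in> tensor_rel R N M"
  shows "\<phi> x y = \<one>\<^bsub>G\<^esub>"
proof -
  interpret N: module R N by fact
  interpret M: module R M by fact
  interpret G: comm_group G by fact
  let ?F = "tensor_free N M"
  interpret F: comm_group ?F by (rule comm_group_tensor_free)
  obtain h where h: "h \<in> hom ?F G"
    and hf: "\<And>p. p \<in> carrier N \<times> carrier M \<Longrightarrow> h (frag_of p) = case_prod \<phi> p"
    using G.free_Abelian_group_universal[of "case_prod \<phi>" "carrier N \<times> carrier M"] \<phi>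
    unfolding tensor_free_def by (smt (verit, best) SigmaE case_prod_conv imageE subsetI)
  interpret h: group_hom ?F G h
    using h by (simp add: group_hom_def group_hom_axioms_def)
  have hd: "h (a - b) = h a \<otimes>\<^bsub>G\<^esub> inv\<^bsub>G\<^esub> h b" if "a \<in> carrier ?F" "b \<in> carrier ?F" for a b
  proof -
    have "a - b = a \<otimes>\<^bsub>?F\<^esub> inv\<^bsub>?F\<^esub> b" using that by simp
    then show ?thesis using that by (simp only: h.hom_mult h.hom_inv F.inv_closed)
  qed
  have hd2: "h (frag_of p - frag_of q) = h (frag_of p) \<otimes>\<^bsub>G\<^esub> inv\<^bsub>G\<^esub> h (frag_of q)"
    if "p \<in> carrier N \<times> carrier M" "q \<in> carrier N \<times> carrier M" for p q
    using that by (intro hd) auto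
  have hd3: "h (frag_of p - frag_of q - frag_of s) =
      h (frag_of p) \<otimes>\<^bsub>G\<^esub> inv\<^bsub>G\<^esub> h (frag_of q) \<otimes>\<^bsub>G\<^esub> inv\<^bsub>G\<^esub> h (frag_of s)"
    if "p \<in> carrier N \<times> carrier M" "q \<in> carrier N \<times> carrier M" "s \<in> carrier N \<times> carrier M" for p q s
  proof -
    have "frag_of p - frag_of q \<in> carrier ?F"
      using that by (auto dest!: keys_diff[THEN subsetD])
    then show ?thesis using that by (subst hd) (auto simp: hd2)
  qed
  let ?S = "{frag_of (x \<oplus>\<^bsub>N\<^esub> x', y) - frag_of (x, y) - frag_of (x', y) | x x' y.
        x \<in> carrier N \<and> x' \<in> carrier N \<and> y \<in> carrier M} \<union>
     {frag_of (x, y \<oplus>\<^bsub>M\<^esub> y') - frag_of (x, y) - frag_of (x, y') | x y y'.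
        x \<in> carrier N \<and> y \<in> carrier M \<and> y' \<in> carrier M} \<union>
     {frag_of (r \<odot>\<^bsub>N\<^esub> x, y) - frag_of (x, r \<odot>\<^bsub>M\<^esub> y) | r x y.
        r \<in> carrier R \<and> x \<in> carrier N \<and> y \<in> carrier M}"
  have inv2: "a \<otimes>\<^bsub>G\<^esub> b \<otimes>\<^bsub>G\<^esub> inv\<^bsub>G\<^esub> a \<otimes>\<^bsub>G\<^esub> inv\<^bsub>G\<^esub> b = \<one>\<^bsub>G\<^esub>" if "a \<in> carrier G" "b \<in> carrier G" for a b
    using that by (metis G.inv_closed G.inv_solve_right G.m_closed G.m_comm G.r_inv)
  have S: "s \<in> carrier ?F \<and> h s = \<one>\<^bsub>G\<^esub>" if "s \<in> ?S" for s
  proof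
    show "s \<in> carrier ?F"
      using that by (auto dest!: keys_diff[THEN subsetD])
    show "h s = \<one>\<^bsub>G\<^esub>"
      using that
    proof (elim UnE CollectE exE conjE)
      fix x x' y assume "s = frag_of (x \<oplus>\<^bsub>N\<^esub> x', y) - frag_of (x, y) - frag_of (x', y)"
        "x \<in> carrier N" "x' \<in> carrier N" "y \<in> carrier M"
      then show ?thesis using \<phi> by (simp add: hd3 hf \<phi>1 inv2)
    next
      fix x y y' assume "s = frag_of (x, y \<oplus>\<^bsub>M\<^esub> y') - frag_of (x, y) - frag_of (x, y')"
        "x \<in> carrier N" "y \<in> carrier M" "y' \<in> carrier M"
      then show ?thesis using \<phi> by (simp add: hd3 hf \<phi>2 inv2)
    next
      fix r x y assume "s = frag_of (r \<odot>\<^bsub>N\<^esub> x, y) - frag_of (x, r \<odot>\<^bsub>M\<^esub> y)"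
        "r \<in> carrier R" "x \<in> carrier N" "y \<in> carrier M"
      then show ?thesis using \<phi> by (simp add: hd2 hf \<phi>3)
    qed
  qed
  have "tensor_rel R N M \<subseteq> kernel ?F G h"
    unfolding tensor_rel_def
  proof (rule F.generate_subgroup_incl[OF _ h.subgroup_kernel], rule subsetI)
    fix s assume "s \<in> ?S"
    from S[OF this] show "s \<in> kernel ?F G h" unfolding kernel_def by blast
  qed
  then have "h (frag_of (x, y)) = \<one>\<^bsub>G\<^esub>" using xy by (auto simp: kernel_def)
  then show ?thesis using hf xy by simp
qed

lemma module_restrict_scalars:
  assumes R: "cring R" and S: "ring S" and h: "h \<in> ring_hom R S"
  shows "module R (restrict_scalars S h)"
proof -
  interpret R: cring R by fact
  interpret S: ring S by fact
  have "abelian_group (restrict_scalars S h)"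
  proof (rule abelian_groupI)
    fix x assume "x \<in> carrier (restrict_scalars S h)"
    then show "\<exists>y\<in>carrier (restrict_scalars S h). y \<oplus>\<^bsub>restrict_scalars S h\<^esub> x = \<zero>\<^bsub>restrict_scalars S h\<^esub>"
      by (intro bexI[of _ "\<ominus>\<^bsub>S\<^esub> x"]) (auto simp: restrict_scalars_def S.l_neg)
  qed (auto simp: restrict_scalars_def S.a_ac)
  then show ?thesis
    using h by (intro moduleI R)
      (auto simp: restrict_scalars_def ring_hom_closed ring_hom_add ring_hom_mult ring_hom_one
        S.l_distr S.r_distr S.m_assoc)
qed

lemma module_ideal_module:
  assumes "cring R" "ideal J R"
  shows "module R (ideal_module R J)"
proof -
  interpret R: cring R by fact
  interpret J: ideal J R by fact
  have "abelian_group (ideal_module R J)"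
  proof (rule abelian_groupI)
    fix x assume "x \<in> carrier (ideal_module R J)"
    then show "\<exists>y\<in>carrier (ideal_module R J). y \<oplus>\<^bsub>ideal_module R J\<^esub> x = \<zero>\<^bsub>ideal_module R J\<^esub>"
      by (intro bexI[of _ "\<ominus>\<^bsub>R\<^esub> x"]) (auto simp: ideal_module_def R.l_neg)
  qed (auto simp: ideal_module_def R.a_ac)
  then show ?thesis
    by (intro moduleI \<open>cring R\<close>)
      (auto simp: ideal_module_def J.I_l_closed R.l_distr R.r_distr R.m_assoc)
qed

lemma tensor_quot_mem:
  fixes N :: "('a, 'n, 'c) module_scheme"
  assumes N: "module R N" and I: "ideal I R" and T: "subgroup T (add_monoid N)"
    and IT: "\<And>b x. \<lbrakk>b \<in> I; x \<in> carrier N\<rbrakk> \<Longrightarrow> b \<odot>\<^bsub>N\<^esub> x \<in> T"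
    and x: "x \<in> carrier N"
    and rel: "frag_of (x, I +>\<^bsub>R\<^esub> \<one>\<^bsub>R\<^esub>) \<in> tensor_rel R N (restrict_scalars (R Quot I) ((+>\<^bsub>R\<^esub>) I))"
  shows "x \<in> T"
proof -
  interpret N: module R N by fact
  interpret I: ideal I R by fact
  let ?Q = "restrict_scalars (R Quot I) ((+>\<^bsub>R\<^esub>) I)"
  have Q: "module R ?Q"
    by (rule module_restrict_scalars[OF N.R.is_cring I.quotient_is_ring I.rcos_ring_hom])
  let ?A = "add_monoid N"
  let ?G = "?A Mod T"
  have G: "comm_group ?G" by (rule N.M.add.abelian_FactGroup[OF T])
  define \<phi> where "\<phi> x X = T #>\<^bsub>?A\<^esub> ((SOME s. s \<in> X) \<odot>\<^bsub>N\<^esub> x)" for x X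
  have QE: "X \<in> carrier ?Q \<longleftrightarrow> (\<exists>s\<in>carrier R. X = I +>\<^bsub>R\<^esub> s)" for X
    by (auto simp: restrict_scalars_def FactRing_def A_RCOSETS_def RCOSETS_def a_r_coset_def)
  have \<phi>: "\<phi> x (I +>\<^bsub>R\<^esub> s) = T #>\<^bsub>?A\<^esub> (s \<odot>\<^bsub>N\<^esub> x)" if "s \<in> carrier R" "x \<in> carrier N" for x s
  proof -
    define t where "t = (SOME t. t \<in> I +>\<^bsub>R\<^esub> s)"
    have "t \<in> I +>\<^bsub>R\<^esub> s"
      unfolding t_def by (rule someI[of _ s]) (rule I.a_rcos_self[OF that(1)])
    then obtain b where b: "b \<in> I" "t = b \<oplus>\<^bsub>R\<^esub> s" by (auto simp: a_r_coset_def r_coset_def)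
    have "t \<odot>\<^bsub>N\<^esub> x = b \<odot>\<^bsub>N\<^esub> x \<oplus>\<^bsub>N\<^esub> s \<odot>\<^bsub>N\<^esub> x"
      using b that by (simp add: N.smult_l_distr)
    then have "t \<odot>\<^bsub>N\<^esub> x \<in> T #>\<^bsub>?A\<^esub> (s \<odot>\<^bsub>N\<^esub> x)"
      using IT[OF b(1) that(2)] by (auto simp: r_coset_def)
    then show ?thesis
      unfolding \<phi>_def t_def[symmetric]
      using N.M.add.repr_independence[OF _ _ T] that by (metis N.smult_closed monoid.select_convs(1) partial_object.select_convs(1))
  qed
  have mult: "(T #>\<^bsub>?A\<^esub> u) <#>\<^bsub>?A\<^esub> (T #>\<^bsub>?A\<^esub> v) = T #>\<^bsub>?A\<^esub> (u \<oplus>\<^bsub>N\<^esub> v)"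
    if "u \<in> carrier N" "v \<in> carrier N" for u v
    using normal.rcos_sum[OF N.M.add.subgroup_imp_normal[OF T], of u v] that by simp
  have "\<phi> x (I +>\<^bsub>R\<^esub> \<one>\<^bsub>R\<^esub>) = \<one>\<^bsub>?G\<^esub>"
  proof (rule tensor_lift[OF N Q G _ _ _ _ x _ rel])
    fix x y assume "x \<in> carrier N" "y \<in> carrier ?Q"
    then show "\<phi> x y \<in> carrier ?G" by (auto simp: QE \<phi> FactGroup_def RCOSETS_def)
  next
    fix x x' y assume "x \<in> carrier N" "x' \<in> carrier N" "y \<in> carrier ?Q"
    then show "\<phi> (x \<oplus>\<^bsub>N\<^esub> x') y = \<phi> x y \<otimes>\<^bsub>?G\<^esub> \<phi> x' y"
      by (auto simp: QE \<phi> mult N.smult_r_distr)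
  next
    fix x y y' assume "x \<in> carrier N" "y \<in> carrier ?Q" "y' \<in> carrier ?Q"
    moreover have "(I +>\<^bsub>R\<^esub> s) \<oplus>\<^bsub>?Q\<^esub> (I +>\<^bsub>R\<^esub> s') = I +>\<^bsub>R\<^esub> (s \<oplus>\<^bsub>R\<^esub> s')"
      if "s \<in> carrier R" "s' \<in> carrier R" for s s'
      using that by (simp add: restrict_scalars_def FactRing_def I.a_rcos_sum)
    ultimately show "\<phi> x (y \<oplus>\<^bsub>?Q\<^esub> y') = \<phi> x y \<otimes>\<^bsub>?G\<^esub> \<phi> x y'"
      by (auto simp: QE \<phi> mult N.smult_l_distr)
  next
    fix r x y assume "r \<in> carrier R" "x \<in> carrier N" "y \<in> carrier ?Q"
    moreover have "r \<odot>\<^bsub>?Q\<^esub> (I +>\<^bsub>R\<^esub> s) = I +>\<^bsub>R\<^esub> (s \<otimes>\<^bsub>R\<^esub> r)" if "s \<in> carrier R" "r \<in> carrier R" for s r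
      using that by (simp add: restrict_scalars_def FactRing_def I.rcoset_mult_add N.R.m_comm)
    ultimately show "\<phi> (r \<odot>\<^bsub>N\<^esub> x) y = \<phi> x (r \<odot>\<^bsub>?Q\<^esub> y)"
      by (auto simp: QE \<phi> N.smult_assoc1)
  next
    show "I +>\<^bsub>R\<^esub> \<one>\<^bsub>R\<^esub> \<in> carrier ?Q" by (auto simp: QE)
  qed
  then have "T #>\<^bsub>?A\<^esub> x = T" using x by (simp add: \<phi>)
  then show ?thesis using N.M.add.coset_join1[OF _ _ T] x by simp
qed

lemma tensor_quot_normal_form:
  assumes N: "module R N" and I: "ideal I R"
    and c: "Poly_Mapping.keys c \<subseteq> carrier N \<times> carrier (restrict_scalars (R Quot I) ((+>\<^bsub>R\<^esub>) I))"
  shows "\<exists>x\<in>carrier N. c - frag_of (x, I +>\<^bsub>R\<^esub> \<one>\<^bsub>R\<^esub>)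
    \<in> tensor_rel R N (restrict_scalars (R Quot I) ((+>\<^bsub>R\<^esub>) I))"
proof -
  interpret N: module R N by fact
  interpret I: ideal I R by fact
  let ?Q = "restrict_scalars (R Quot I) ((+>\<^bsub>R\<^esub>) I)"
  let ?one = "I +>\<^bsub>R\<^esub> \<one>\<^bsub>R\<^esub>"
  have Q: "module R ?Q"
    by (rule module_restrict_scalars[OF N.R.is_cring I.quotient_is_ring I.rcos_ring_hom])
  have QE: "X \<in> carrier ?Q \<longleftrightarrow> (\<exists>s\<in>carrier R. X = I +>\<^bsub>R\<^esub> s)" for X
    by (auto simp: restrict_scalars_def FactRing_def A_RCOSETS_def RCOSETS_def a_r_coset_def)
  have one: "?one \<in> carrier ?Q" by (auto simp: QE)
  note cl = tensor_rel_closed[OF N Q]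
  show ?thesis
    using c
  proof (induction c rule: frag_induction)
    case zero
    show ?case
      using tensor_rel_basic(1)[OF N.M.zero_closed N.M.zero_closed one, of R]
      by (intro bexI[of _ "\<zero>\<^bsub>N\<^esub>"]) simp_all
  next
    case (one p)
    then obtain x s where p: "p = (x, I +>\<^bsub>R\<^esub> s)" "x \<in> carrier N" "s \<in> carrier R"
      by (auto simp: QE)
    have "s \<odot>\<^bsub>?Q\<^esub> ?one = I +>\<^bsub>R\<^esub> s"
      using p by (simp add: restrict_scalars_def FactRing_def I.rcoset_mult_add)
    then have "frag_of (s \<odot>\<^bsub>N\<^esub> x, ?one) - frag_of p \<in> tensor_rel R N ?Q"
      using tensor_rel_basic(3)[where M = ?Q, OF p(3,2) \<open>?one \<in> carrier ?Q\<close>] p by simp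
    from cl(3)[OF this] show ?case using p by auto
  next
    case (diff a b)
    then obtain x y where xy: "x \<in> carrier N" "y \<in> carrier N"
      and a: "a - frag_of (x, ?one) \<in> tensor_rel R N ?Q"
      and b: "b - frag_of (y, ?one) \<in> tensor_rel R N ?Q"
      by blast
    have "x \<ominus>\<^bsub>N\<^esub> y \<oplus>\<^bsub>N\<^esub> y = x"
      using xy by (simp add: N.M.minus_eq N.M.a_assoc N.M.l_neg)
    then have "frag_of (x, ?one) - frag_of (x \<ominus>\<^bsub>N\<^esub> y, ?one) - frag_of (y, ?one) \<in> tensor_rel R N ?Q"
      using tensor_rel_basic(1)[of "x \<ominus>\<^bsub>N\<^esub> y" N y ?one ?Q R] xy one by simp
    from cl(2)[OF this cl(4)[OF a b]]
    show ?case using xy by (intro bexI[of _ "x \<ominus>\<^bsub>N\<^esub> y"]) simp_all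
  qed
qed

lemma pure_imp_flat:
  assumes R: "cring R" and I: "ideal I R"
    and el: "\<And>a. a \<in> I \<Longrightarrow> \<exists>b\<in>I. a \<otimes>\<^bsub>R\<^esub> (\<one>\<^bsub>R\<^esub> \<ominus>\<^bsub>R\<^esub> b) = \<zero>\<^bsub>R\<^esub>"
  shows "flat_hom TYPE('n) R (R Quot I) ((+>\<^bsub>R\<^esub>) I)"
proof -
  interpret R: cring R by fact
  interpret I: ideal I R by fact
  let ?Q = "restrict_scalars (R Quot I) ((+>\<^bsub>R\<^esub>) I)"
  let ?one = "I +>\<^bsub>R\<^esub> \<one>\<^bsub>R\<^esub>"
  have Q: "module R ?Q"
    by (rule module_restrict_scalars[OF R I.quotient_is_ring I.rcos_ring_hom])
  have one: "?one \<in> carrier ?Q"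
    by (auto simp: restrict_scalars_def FactRing_def A_RCOSETS_def RCOSETS_def a_r_coset_def)
  have el': "\<exists>b\<in>I. a = a \<otimes>\<^bsub>R\<^esub> b" if a: "a \<in> I" for a
  proof -
    obtain b where b: "b \<in> I" "a \<otimes>\<^bsub>R\<^esub> (\<one>\<^bsub>R\<^esub> \<ominus>\<^bsub>R\<^esub> b) = \<zero>\<^bsub>R\<^esub>" using el[OF a] by blast
    have ab: "a \<in> carrier R" "b \<in> carrier R" using a b(1) I.Icarr by auto
    have "a = a \<otimes>\<^bsub>R\<^esub> (\<one>\<^bsub>R\<^esub> \<ominus>\<^bsub>R\<^esub> b) \<oplus>\<^bsub>R\<^esub> a \<otimes>\<^bsub>R\<^esub> b" using ab by algebra
    then show ?thesis using b ab by auto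
  qed
  have "inj_on (tensor_map R N' ?Q f) (carrier (tensor R N ?Q))"
    if N: "module R N" and N': "module R N'" and f: "f \<in> linear_maps R N N'"
      and inj: "inj_on f (carrier N)" for N N' :: "('a, 'n) module" and f
    unfolding inj_tensor_map_iff[OF N N' Q f]
  proof (intro ballI impI)
    interpret N: module R N by fact
    interpret N': module R N' by fact
    let ?g = "frag_extend (\<lambda>(x, y). frag_of (f x, y))"
    note cl = tensor_rel_closed[OF N Q] and cl' = tensor_rel_closed[OF N' Q]
    define T where "T = {x \<in> carrier N'. \<exists>b\<in>I. b \<odot>\<^bsub>N'\<^esub> x = x}"
    have T: "subgroup T (add_monoid N')"
    proof
      show "T \<subseteq> carrier (add_monoid N')" by (auto simp: T_def)
      show "\<one>\<^bsub>add_monoid N'\<^esub> \<in> T"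
      proof -
        have "\<zero>\<^bsub>R\<^esub> \<odot>\<^bsub>N'\<^esub> \<zero>\<^bsub>N'\<^esub> = \<zero>\<^bsub>N'\<^esub>" by simp
        then have "\<exists>b\<in>I. b \<odot>\<^bsub>N'\<^esub> \<zero>\<^bsub>N'\<^esub> = \<zero>\<^bsub>N'\<^esub>"
          using additive_subgroup.zero_closed[OF ideal.axioms(1)[OF I]] by blast
        then show ?thesis by (simp add: T_def)
      qed
    next
      fix x y assume "x \<in> T" "y \<in> T"
      then obtain b c where x: "x \<in> carrier N'" "b \<in> I" "b \<odot>\<^bsub>N'\<^esub> x = x"
        and y: "y \<in> carrier N'" "c \<in> I" "c \<odot>\<^bsub>N'\<^esub> y = y" by (auto simp: T_def)
      have bc: "b \<in> carrier R" "c \<in> carrier R" using x y I.Icarr by auto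
      let ?d = "b \<oplus>\<^bsub>R\<^esub> (\<one>\<^bsub>R\<^esub> \<ominus>\<^bsub>R\<^esub> b) \<otimes>\<^bsub>R\<^esub> c"
      have d1: "?d = c \<oplus>\<^bsub>R\<^esub> (\<one>\<^bsub>R\<^esub> \<ominus>\<^bsub>R\<^esub> c) \<otimes>\<^bsub>R\<^esub> b" using bc by algebra
      have "?d \<in> I" using x y bc by (simp add: I.I_l_closed)
      have z: "(\<one>\<^bsub>R\<^esub> \<ominus>\<^bsub>R\<^esub> e) \<odot>\<^bsub>N'\<^esub> u = \<zero>\<^bsub>N'\<^esub>"
        if "e \<in> carrier R" "u \<in> carrier N'" "e \<odot>\<^bsub>N'\<^esub> u = u" for e u
        using that by (simp add: R.minus_eq N'.smult_l_distr N'.smult_l_minus N'.M.r_neg)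
      have k: "(e \<oplus>\<^bsub>R\<^esub> (\<one>\<^bsub>R\<^esub> \<ominus>\<^bsub>R\<^esub> e) \<otimes>\<^bsub>R\<^esub> e') \<odot>\<^bsub>N'\<^esub> u = u"
        if "e \<in> carrier R" "e' \<in> carrier R" "u \<in> carrier N'" "e \<odot>\<^bsub>N'\<^esub> u = u" for e e' u
      proof -
        have "((\<one>\<^bsub>R\<^esub> \<ominus>\<^bsub>R\<^esub> e) \<otimes>\<^bsub>R\<^esub> e') \<odot>\<^bsub>N'\<^esub> u = (e' \<otimes>\<^bsub>R\<^esub> (\<one>\<^bsub>R\<^esub> \<ominus>\<^bsub>R\<^esub> e)) \<odot>\<^bsub>N'\<^esub> u"
          using that by (simp add: R.m_comm)
        then show ?thesis
          using that z[of e u] by (simp add: N'.smult_l_distr N'.smult_assoc1)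
      qed
      have "?d \<odot>\<^bsub>N'\<^esub> x = x" using k[of b c x] x bc by simp
      moreover have "?d \<odot>\<^bsub>N'\<^esub> y = y" unfolding d1 using k[of c b y] y bc by simp
      ultimately have "?d \<odot>\<^bsub>N'\<^esub> (x \<oplus>\<^bsub>N'\<^esub> y) = x \<oplus>\<^bsub>N'\<^esub> y"
        using x y bc by (simp add: N'.smult_r_distr)
      then show "x \<otimes>\<^bsub>add_monoid N'\<^esub> y \<in> T"
        using x y \<open>?d \<in> I\<close> by (auto simp: T_def)
    next
      fix x assume "x \<in> T"
      then obtain b where x: "x \<in> carrier N'" "b \<in> I" "b \<odot>\<^bsub>N'\<^esub> x = x" by (auto simp: T_def)
      have "\<ominus>\<^bsub>N'\<^esub> x \<in> T"
      proof -
        have "b \<odot>\<^bsub>N'\<^esub> (\<ominus>\<^bsub>N'\<^esub> x) = \<ominus>\<^bsub>N'\<^esub> x"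
          using x I.Icarr by (simp add: N'.smult_r_minus)
        then show ?thesis using x(1,2) N'.M.a_inv_closed[OF x(1)] unfolding T_def by blast
      qed
      then show "inv\<^bsub>add_monoid N'\<^esub> x \<in> T" by (simp add: a_inv_def)
    qed
    fix c assume c: "c \<in> carrier (tensor_free N ?Q)" and gc: "?g c \<in> tensor_rel R N' ?Q"
    obtain x where x: "x \<in> carrier N" and cx: "c - frag_of (x, ?one) \<in> tensor_rel R N ?Q"
      using tensor_quot_normal_form[OF N I] c by auto
    have fx: "f x \<in> carrier N'" using f x by (auto simp: linear_maps_def)
    have gH: "?g h \<in> tensor_rel R N' ?Q" if "h \<in> tensor_rel R N ?Q" for h
      using tensor_rel_map[OF N N' Q f that] .
    have "frag_of (f x, ?one) = ?g c - ?g (c - frag_of (x, ?one))"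
      by (simp add: frag_extend_diff)
    then have "frag_of (f x, ?one) \<in> tensor_rel R N' ?Q"
      using cl'(4)[OF gc gH[OF cx]] by simp
    moreover have "b \<odot>\<^bsub>N'\<^esub> u \<in> T" if bu: "b \<in> I" "u \<in> carrier N'" for b u
    proof -
      obtain b' where b': "b' \<in> I" "b = b \<otimes>\<^bsub>R\<^esub> b'" using el'[OF bu(1)] by blast
      have "b' \<odot>\<^bsub>N'\<^esub> (b \<odot>\<^bsub>N'\<^esub> u) = b \<odot>\<^bsub>N'\<^esub> u"
        using b' bu I.Icarr by (metis N'.smult_assoc1 R.m_comm)
      then show ?thesis using b' bu I.Icarr by (auto simp: T_def)
    qed
    ultimately have "f x \<in> T"
      using tensor_quot_mem[OF N' I T _ fx] by blast
    then obtain b where b: "b \<in> I" "b \<odot>\<^bsub>N'\<^esub> f x = f x" by (auto simp: T_def)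
    have bR: "b \<in> carrier R" using b I.Icarr by auto
    have "f (b \<odot>\<^bsub>N\<^esub> x) = f x" using f b bR x by (simp add: linear_maps_def)
    then have bx: "b \<odot>\<^bsub>N\<^esub> x = x" using inj bR x by (simp add: inj_on_def)
    have Z: "b \<odot>\<^bsub>?Q\<^esub> ?one = \<zero>\<^bsub>?Q\<^esub>"
    proof -
      have "b \<odot>\<^bsub>?Q\<^esub> ?one = I +>\<^bsub>R\<^esub> b"
        using bR by (simp add: restrict_scalars_def FactRing_def I.rcoset_mult_add)
      also have "\<dots> = I" using b by (intro I.a_rcos_const) simp
      finally show ?thesis by (simp add: restrict_scalars_def FactRing_def)
    qed
    interpret Q: module R ?Q by fact
    have "frag_of (x, ?one) - frag_of (x, \<zero>\<^bsub>?Q\<^esub>) \<in> tensor_rel R N ?Q"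
      using tensor_rel_basic(3)[where M = ?Q, OF bR x one] bx Z by simp
    moreover have "frag_of (x, \<zero>\<^bsub>?Q\<^esub>) \<in> tensor_rel R N ?Q"
      using cl(3)[OF tensor_rel_basic(2)[where M = ?Q, OF x Q.M.zero_closed Q.M.zero_closed]] by simp
    ultimately have "frag_of (x, ?one) \<in> tensor_rel R N ?Q" using cl(2) by fastforce
    from cl(2)[OF cx this] show "c \<in> tensor_rel R N ?Q" by simp
  qed
  then show ?thesis
    unfolding flat_hom_def flat_module_def using Q I.rcos_ring_hom by blast
qed

lemma pure_ideal_iff:
  assumes R: "cring R"
  shows "pure_ideal I R \<longleftrightarrow>
    ideal I R \<and> (\<forall>a\<in>I. \<exists>b\<in>I. a \<otimes>\<^bsub>R\<^esub> (\<one>\<^bsub>R\<^esub> \<ominus>\<^bsub>R\<^esub> b) = \<zero>\<^bsub>R\<^esub>)"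
proof
  assume "ideal I R \<and> (\<forall>a\<in>I. \<exists>b\<in>I. a \<otimes>\<^bsub>R\<^esub> (\<one>\<^bsub>R\<^esub> \<ominus>\<^bsub>R\<^esub> b) = \<zero>\<^bsub>R\<^esub>)"
  then show "pure_ideal I R"
    unfolding pure_ideal_def using pure_imp_flat[OF R] by blast
next
  assume pure: "pure_ideal I R"
  then have I: "ideal I R" by (simp add: pure_ideal_def)
  interpret R: cring R by fact
  interpret I: ideal I R by fact
  let ?Q = "restrict_scalars (R Quot I) ((+>\<^bsub>R\<^esub>) I)"
  let ?one = "I +>\<^bsub>R\<^esub> \<one>\<^bsub>R\<^esub>"
  have Q: "module R ?Q"
    by (rule module_restrict_scalars[OF R I.quotient_is_ring I.rcos_ring_hom])
  interpret Q: module R ?Q by fact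
  have one: "?one \<in> carrier ?Q"
    by (auto simp: restrict_scalars_def FactRing_def A_RCOSETS_def RCOSETS_def a_r_coset_def)
  show "ideal I R \<and> (\<forall>a\<in>I. \<exists>b\<in>I. a \<otimes>\<^bsub>R\<^esub> (\<one>\<^bsub>R\<^esub> \<ominus>\<^bsub>R\<^esub> b) = \<zero>\<^bsub>R\<^esub>)"
  proof (intro conjI I ballI)
    fix a assume aI: "a \<in> I"
    then have a: "a \<in> carrier R" using I.Icarr by simp
    let ?N = "ideal_module R (PIdl\<^bsub>R\<^esub> a)" and ?R = "ideal_module R (carrier R)"
    have N: "module R ?N" by (rule module_ideal_module[OF R R.cgenideal_ideal[OF a]])
    have N': "module R ?R" by (rule module_ideal_module[OF R R.oneideal])
    note cl = tensor_rel_closed[OF N' Q]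
    have sub: "PIdl\<^bsub>R\<^esub> a \<subseteq> carrier R" using a by (auto simp: cgenideal_def)
    have id: "(\<lambda>x. x) \<in> linear_maps R ?N ?R"
      using sub by (auto simp: linear_maps_def ideal_module_def)
    have aN: "a \<in> carrier ?N" using R.cgenideal_self[OF a] by (simp add: ideal_module_def)
    have "inj_on (tensor_map R ?R ?Q (\<lambda>x. x)) (carrier (tensor R ?N ?Q))"
      using pure N N' id unfolding pure_ideal_def flat_hom_def flat_module_def by auto
    then have *: "c \<in> tensor_rel R ?N ?Q"
      if "c \<in> carrier (tensor_free ?N ?Q)" "frag_extend (\<lambda>(x, y). frag_of (x, y)) c \<in> tensor_rel R ?R ?Q" for c
      using that unfolding inj_tensor_map_iff[OF N N' Q id] by blast
    have oR: "\<one>\<^bsub>R\<^esub> \<in> carrier ?R" by (simp add: ideal_module_def)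
    have Z: "a \<odot>\<^bsub>?Q\<^esub> ?one = \<zero>\<^bsub>?Q\<^esub>"
    proof -
      have "a \<odot>\<^bsub>?Q\<^esub> ?one = I +>\<^bsub>R\<^esub> a"
        using a by (simp add: restrict_scalars_def FactRing_def I.rcoset_mult_add)
      also have "\<dots> = I" using aI by (intro I.a_rcos_const) simp
      finally show ?thesis by (simp add: restrict_scalars_def FactRing_def)
    qed
    have "frag_of (a, ?one) - frag_of (\<one>\<^bsub>R\<^esub>, \<zero>\<^bsub>?Q\<^esub>) \<in> tensor_rel R ?R ?Q"
      using tensor_rel_basic(3)[where M = ?Q, OF a oR one] Z a by (simp add: ideal_module_def)
    moreover have "frag_of (\<one>\<^bsub>R\<^esub>, \<zero>\<^bsub>?Q\<^esub>) \<in> tensor_rel R ?R ?Q"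
      using cl(3)[OF tensor_rel_basic(2)[where M = ?Q, OF oR Q.M.zero_closed Q.M.zero_closed]] by simp
    ultimately have "frag_of (a, ?one) \<in> tensor_rel R ?R ?Q" using cl(2) by fastforce
    then have rel: "frag_of (a, ?one) \<in> tensor_rel R ?N ?Q"
      using *[of "frag_of (a, ?one)"] aN one by simp
    define T where "T = (\<lambda>b. a \<otimes>\<^bsub>R\<^esub> b) ` I"
    interpret N: module R ?N by fact
    have "T \<subseteq> PIdl\<^bsub>R\<^esub> a"
      using a I.Icarr by (auto simp: T_def cgenideal_def R.m_comm)
    have minusN: "\<ominus>\<^bsub>?N\<^esub> x = \<ominus>\<^bsub>R\<^esub> x" if "x \<in> carrier ?N" for x
    proof (rule N.M.minus_equality)
      have x: "x \<in> PIdl\<^bsub>R\<^esub> a" using that by (simp add: ideal_module_def)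
      then show "\<ominus>\<^bsub>R\<^esub> x \<in> carrier ?N"
        using additive_subgroup.a_inv_closed[OF ideal.axioms(1)[OF R.cgenideal_ideal[OF a]]]
        by (simp add: ideal_module_def)
      show "\<ominus>\<^bsub>R\<^esub> x \<oplus>\<^bsub>?N\<^esub> x = \<zero>\<^bsub>?N\<^esub>"
        using x sub R.l_neg by (auto simp: ideal_module_def)
    qed fact
    have T: "subgroup T (add_monoid ?N)"
    proof
      show "T \<subseteq> carrier (add_monoid ?N)"
        using \<open>T \<subseteq> PIdl\<^bsub>R\<^esub> a\<close> by (simp add: ideal_module_def)
      show "\<one>\<^bsub>add_monoid ?N\<^esub> \<in> T"
        using a by (auto simp: T_def ideal_module_def intro!: image_eqI[of _ _ "\<zero>\<^bsub>R\<^esub>"])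
    next
      fix x y assume "x \<in> T" "y \<in> T"
      then obtain b c where "b \<in> I" "c \<in> I" "x = a \<otimes>\<^bsub>R\<^esub> b" "y = a \<otimes>\<^bsub>R\<^esub> c" by (auto simp: T_def)
      then show "x \<otimes>\<^bsub>add_monoid ?N\<^esub> y \<in> T"
        using a I.Icarr
        by (auto simp: T_def ideal_module_def R.r_distr intro!: image_eqI[of _ _ "b \<oplus>\<^bsub>R\<^esub> c"])
    next
      fix x assume xT: "x \<in> T"
      then obtain b where b: "b \<in> I" "x = a \<otimes>\<^bsub>R\<^esub> b" by (auto simp: T_def)
      have "x \<in> carrier ?N" using xT \<open>T \<subseteq> PIdl\<^bsub>R\<^esub> a\<close> by (auto simp: ideal_module_def)
      from minusN[OF this] have "inv\<^bsub>add_monoid ?N\<^esub> x = \<ominus>\<^bsub>R\<^esub> x"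
        by (simp add: a_inv_def)
      also have "\<dots> = a \<otimes>\<^bsub>R\<^esub> (\<ominus>\<^bsub>R\<^esub> b)" using b a I.Icarr by (simp add: R.r_minus)
      finally show "inv\<^bsub>add_monoid ?N\<^esub> x \<in> T" using b by (auto simp: T_def)
    qed
    have "a \<in> T"
    proof (rule tensor_quot_mem[OF N I T _ aN rel])
      fix b x assume b: "b \<in> I" and "x \<in> carrier ?N"
      then obtain r where r: "r \<in> carrier R" "x = r \<otimes>\<^bsub>R\<^esub> a"
        by (auto simp: ideal_module_def cgenideal_def)
      have bR: "b \<in> carrier R" using b I.Icarr by simp
      have "b \<odot>\<^bsub>?N\<^esub> x = a \<otimes>\<^bsub>R\<^esub> (b \<otimes>\<^bsub>R\<^esub> r)"
        using r bR a by (simp add: ideal_module_def) algebra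
      then show "b \<odot>\<^bsub>?N\<^esub> x \<in> T" using b r I.I_r_closed by (auto simp: T_def)
    qed
    then obtain b where b: "b \<in> I" "a = a \<otimes>\<^bsub>R\<^esub> b" by (auto simp: T_def)
    have "b \<in> carrier R" using b I.Icarr by simp
    then have "a \<otimes>\<^bsub>R\<^esub> (\<one>\<^bsub>R\<^esub> \<ominus>\<^bsub>R\<^esub> b) = a \<ominus>\<^bsub>R\<^esub> a \<otimes>\<^bsub>R\<^esub> b" using a by algebra
    then have "a \<otimes>\<^bsub>R\<^esub> (\<one>\<^bsub>R\<^esub> \<ominus>\<^bsub>R\<^esub> b) = \<zero>\<^bsub>R\<^esub>"
      using a b(2) by (simp add: R.minus_eq R.r_neg)
    then show "\<exists>b\<in>I. a \<otimes>\<^bsub>R\<^esub> (\<one>\<^bsub>R\<^esub> \<ominus>\<^bsub>R\<^esub> b) = \<zero>\<^bsub>R\<^esub>" using b by blast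
  qed
qed

lemma pure_ideal_flat:
  assumes "cring R" "pure_ideal I R"
  shows "flat_hom TYPE('n) R (R Quot I) ((+>\<^bsub>R\<^esub>) I)"
proof (rule pure_imp_flat[OF assms(1)])
  note * = assms(2)[unfolded pure_ideal_iff[OF assms(1)]]
  show "ideal I R" using * by simp
  fix a assume "a \<in> I"
  then show "\<exists>b\<in>I. a \<otimes>\<^bsub>R\<^esub> (\<one>\<^bsub>R\<^esub> \<ominus>\<^bsub>R\<^esub> b) = \<zero>\<^bsub>R\<^esub>" using * by simp
qed

end

theory Submission
  imports Defs
begin

text \<open>For endomorphisms \<open>f\<close> and \<open>g\<close> of an ideal \<open>J\<close> and elements \<open>x\<close> and \<open>y\<close> of \<open>J\<close>, every factor
  of the product \<open>x y\<close> can serve as a scalar or as a vector, so that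
  \<open>f (g (x y)) = f (x g(y)) = f(x) g(y) = g (f(x) y) = g (f (x y))\<close>. Hence \<open>f\<close> and \<open>g\<close> commute on
  \<open>J\<^sup>2\<close>, and the endomorphism ring is commutative as soon as \<open>J\<^sup>2 = J\<close>
  (\<open>cring_End_ring_idempotent_ideal\<close>).

  A pure ideal \<open>I\<close> is idempotent: if \<open>a (1 - b) = 0\<close> with \<open>b\<close> in \<open>I\<close>, then \<open>a = a b\<close> is a product of
  two elements of \<open>I\<close>. All positive powers of \<open>I\<close> therefore coincide with \<open>I\<close>, and the previous
  argument applies to \<open>J = I\<close>.\<close>

lemma linear_mapsD:
  assumes "f \<in> linear_maps R M N"
  shows "x \<in> carrier M \<Longrightarrow> f x \<in> carrier N"
    and "\<lbrakk>x \<in> carrier M; y \<in> carrier M\<rbrakk> \<Longrightarrow> f (x \<oplus>\<^bsub>M\<^esub> y) = f x \<oplus>\<^bsub>N\<^esub> f y"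
    and "\<lbrakk>r \<in> carrier R; x \<in> carrier M\<rbrakk> \<Longrightarrow> f (r \<odot>\<^bsub>M\<^esub> x) = r \<odot>\<^bsub>N\<^esub> f x"
  using assms by (auto simp: linear_maps_def)

theorem ring_End_ring:
  fixes M :: "('a, 'm, 'c) module_scheme"
  assumes M: "module R M"
  shows "ring (End_ring R M)"
proof -
  interpret M: module R M by fact
  let ?E = "carrier (End_ring R M)"
  have E: "f \<in> ?E \<longleftrightarrow> f \<in> linear_maps R M M \<and> f \<in> extensional (carrier M)" for f
    by (simp add: End_ring_def)
  have ext: "f = g"
    if "f \<in> extensional (carrier M)" "g \<in> extensional (carrier M)"
      "\<And>x. x \<in> carrier M \<Longrightarrow> f x = g x" for f g :: "'m \<Rightarrow> 'm"
    using that by (rule extensionalityI)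
  have add: "f \<oplus>\<^bsub>End_ring R M\<^esub> g \<in> ?E" if "f \<in> ?E" "g \<in> ?E" for f g
    using that unfolding E
    by (auto simp: End_ring_def linear_maps_def Pi_iff M.smult_r_distr M.M.a_ac)
  have mult: "f \<otimes>\<^bsub>End_ring R M\<^esub> g \<in> ?E" if "f \<in> ?E" "g \<in> ?E" for f g
    using that unfolding E
    by (auto simp: End_ring_def linear_maps_def Pi_iff compose_def)
  have zero: "\<zero>\<^bsub>End_ring R M\<^esub> \<in> ?E" and one: "\<one>\<^bsub>End_ring R M\<^esub> \<in> ?E"
    unfolding E by (auto simp: End_ring_def linear_maps_def)
  have neg: "\<exists>g\<in>?E. g \<oplus>\<^bsub>End_ring R M\<^esub> f = \<zero>\<^bsub>End_ring R M\<^esub>" if f: "f \<in> ?E" for f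
  proof
    let ?g = "\<lambda>x\<in>carrier M. \<ominus>\<^bsub>M\<^esub> f x"
    show "?g \<in> ?E"
      using f unfolding E
      by (auto simp: linear_maps_def Pi_iff M.smult_r_minus M.M.minus_add)
    show "?g \<oplus>\<^bsub>End_ring R M\<^esub> f = \<zero>\<^bsub>End_ring R M\<^esub>"
      using f unfolding E
      by (auto simp: End_ring_def linear_maps_def Pi_iff M.M.l_neg intro!: ext)
  qed
  have "abelian_group (End_ring R M)"
    by (rule abelian_groupI[OF add zero _ _ _ neg], assumption+)
      (auto simp: End_ring_def linear_maps_def Pi_iff M.M.a_ac intro!: ext)
  moreover have "monoid (End_ring R M)"
    by (rule monoidI[OF mult one], assumption+)
      (auto simp: End_ring_def linear_maps_def Pi_iff compose_def intro!: ext)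
  ultimately show ?thesis
    by (rule ringI)
      (auto simp: End_ring_def linear_maps_def Pi_iff compose_def intro!: ext)
qed

text \<open>On a product of two elements of \<open>J\<close>, one map can act on the first factor and the other on the
  second, and such actions do not interfere. Additivity carries the identity over from the products
  to all of \<open>J\<^sup>2\<close>, whose elements are finite sums of products.\<close>

lemma linear_maps_commute_on_ideal_prod:
  assumes R: "cring R" and J: "ideal J R"
    and f: "f \<in> linear_maps R (ideal_module R J) (ideal_module R J)"
    and g: "g \<in> linear_maps R (ideal_module R J) (ideal_module R J)"
    and x: "x \<in> J \<cdot>\<^bsub>R\<^esub> J"
  shows "f (g x) = g (f x)"
proof -
  interpret R: cring R by fact
  interpret J: ideal J R by fact
  have closed: "h x \<in> J"
    and h_add: "y \<in> J \<Longrightarrow> h (x \<oplus>\<^bsub>R\<^esub> y) = h x \<oplus>\<^bsub>R\<^esub> h y"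
    and mult_right: "r \<in> J \<Longrightarrow> h (r \<otimes>\<^bsub>R\<^esub> x) = r \<otimes>\<^bsub>R\<^esub> h x"
    if "h \<in> linear_maps R (ideal_module R J) (ideal_module R J)" "x \<in> J" for h x y r
    using linear_mapsD[OF that(1)] that(2) J.Icarr by (auto simp: ideal_module_def)
  have mult_left: "h (x \<otimes>\<^bsub>R\<^esub> r) = h x \<otimes>\<^bsub>R\<^esub> r"
    if "h \<in> linear_maps R (ideal_module R J) (ideal_module R J)" "x \<in> J" "r \<in> J" for h x r
    using mult_right[OF that] closed[OF that(1,2)] that(2,3) J.Icarr by (simp add: R.m_comm)
  have sub: "J \<cdot>\<^bsub>R\<^esub> J \<subseteq> J" using R.ideal_prod_inter[OF J J] by simp
  show ?thesis
    using x
  proof (induction rule: ideal_prod.induct)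
    case (prod x y)
    have "f (g (x \<otimes>\<^bsub>R\<^esub> y)) = f (x \<otimes>\<^bsub>R\<^esub> g y)"
      using prod by (simp add: mult_right[OF g])
    also have "\<dots> = f x \<otimes>\<^bsub>R\<^esub> g y"
      using prod closed[OF g] by (simp add: mult_left[OF f])
    also have "\<dots> = g (f x \<otimes>\<^bsub>R\<^esub> y)"
      using prod closed[OF f] by (simp add: mult_right[OF g])
    also have "\<dots> = g (f (x \<otimes>\<^bsub>R\<^esub> y))"
      using prod by (simp add: mult_left[OF f])
    finally show ?case .
  next
    case (sum x y)
    then have "x \<in> J" "y \<in> J" using sub by auto
    then show ?case
      using sum.IH by (simp add: h_add[OF f] h_add[OF g] closed[OF f] closed[OF g])
  qed
qed

theorem cring_End_ring_idempotent_ideal: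
  assumes R: "cring R" and J: "ideal J R" and idem: "J \<cdot>\<^bsub>R\<^esub> J = J"
  shows "cring (End_ring R (ideal_module R J))"
proof -
  let ?E = "End_ring R (ideal_module R J)"
  interpret E: ring ?E
    by (rule ring_End_ring[OF module_ideal_module[OF R J]])
  have "f \<otimes>\<^bsub>?E\<^esub> g = g \<otimes>\<^bsub>?E\<^esub> f" if "f \<in> carrier ?E" "g \<in> carrier ?E" for f g
    using that linear_maps_commute_on_ideal_prod[OF R J, of f g] idem
    by (auto simp: End_ring_def compose_def ideal_module_def intro!: restrict_ext)
  then show ?thesis
    by unfold_locales
qed

lemma pure_ideal_idempotent:
  assumes R: "cring R" and pure: "pure_ideal I R"
  shows "I \<cdot>\<^bsub>R\<^esub> I = I"
proof
  interpret R: cring R by fact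
  have I: "ideal I R" using pure by (simp add: pure_ideal_def)
  interpret I: ideal I R by fact
  show "I \<cdot>\<^bsub>R\<^esub> I \<subseteq> I" using R.ideal_prod_inter[OF I I] by simp
  show "I \<subseteq> I \<cdot>\<^bsub>R\<^esub> I"
  proof
    fix a assume a: "a \<in> I"
    then obtain b where b: "b \<in> I" "a \<otimes>\<^bsub>R\<^esub> (\<one>\<^bsub>R\<^esub> \<ominus>\<^bsub>R\<^esub> b) = \<zero>\<^bsub>R\<^esub>"
      using pure unfolding pure_ideal_iff[OF R] by blast
    have carr: "a \<in> carrier R" "b \<in> carrier R" using a b I.Icarr by auto
    have "a = a \<otimes>\<^bsub>R\<^esub> (\<one>\<^bsub>R\<^esub> \<ominus>\<^bsub>R\<^esub> b) \<oplus>\<^bsub>R\<^esub> a \<otimes>\<^bsub>R\<^esub> b" using carr by algebra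
    also have "\<dots> = a \<otimes>\<^bsub>R\<^esub> b" using carr b(2) by simp
    finally show "a \<in> I \<cdot>\<^bsub>R\<^esub> I" using ideal_prod.prod[OF a b(1), of R] by simp
  qed
qed

lemma (in monoid) idempotent_nat_pow:
  assumes "x \<in> carrier G" "x \<otimes> x = x" "n \<ge> 1"
  shows "x [^] (n :: nat) = x"
  using assms(3) by (induction n rule: dec_induct) (simp_all add: assms)

theorem theorem3p20:
  fixes R :: "('a, 'b) ring_scheme" and I :: "'a set" and n :: nat
  assumes "cring R"
    and "pure_ideal I R"
    and "n \<ge> 1"
  shows "cring (End_ring R (ideal_module R (I [^]\<^bsub>ideals_set R\<^esub> n)))"
proof -
  have I: "ideal I R" using assms(2) by (simp add: pure_ideal_def)
  have idem: "I \<cdot>\<^bsub>R\<^esub> I = I" using assms(1,2) by (rule pure_ideal_idempotent)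
  interpret S: comm_monoid "ideals_set R"
    using assms(1) by (rule cring.ideals_set_is_comm_monoid)
  have "I [^]\<^bsub>ideals_set R\<^esub> n = I"
    using I idem assms(3) by (intro S.idempotent_nat_pow) (simp_all add: ideals_set_def)
  then show ?thesis
    using cring_End_ring_idempotent_ideal[OF assms(1) I idem] by simp
qed

end
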